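(* Let $n \ge 2$ be an integer, let $\Sigma$ be a finite alphabet of size $q$, let $\ell, L$ be integers with $q > L \ge \ell \ge 1$, and let $R \in [0,1]$. Let $\rho \in [0,1]$ be such that $$\rho \ \le\ \frac{L+1-\ell}{L+1} - \frac{L}{L+1}\, R .$$ Let $$k = \left\lfloor Rn - \frac{(L+1)\log(L+1)}{\log q}\,(n+3) - 1 \right\rfloor$$ and assume $k \ge 1$. Then there exists a code $C \subseteq \Sigma^n$ of size $q^k$ that is $(\rho,\ell,L)$ list-recoverable.
   Context: A code $C \subseteq \Sigma^n$ is $(\rho,\ell,L)$ list-recoverable if for every collection of sets $S_1,\dots,S_n \subseteq \Sigma$ with $|S_i| \le \ell$ for all $i \in [n]$, there are at most $L$ codewords $c \in C$ such that $c_i \in S_i$ for at least $(1-\rho)n$ of the indices $i \in [n]$. *)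

theory Defs
  imports Complex_Main "HOL-Library.FuncSet"
begin

text \<open>Words of length \<open>n\<close> over \<open>\<Sigma>\<close> are extensional functions on the index set \<open>{..<n}\<close>.\<close>

abbreviation words :: "'a set \<Rightarrow> nat \<Rightarrow> (nat \<Rightarrow> 'a) set" where
  "words \<Sigma> n \<equiv> {..<n} \<rightarrow>\<^sub>E \<Sigma>"

definition agreeing_codewords ::
    "nat \<Rightarrow> (nat \<Rightarrow> 'a) set \<Rightarrow> real \<Rightarrow> (nat \<Rightarrow> 'a set) \<Rightarrow> (nat \<Rightarrow> 'a) set" where
  "agreeing_codewords n C \<rho> S =
     {c \<in> C. real (card {i. i < n \<and> c i \<in> S i}) \<ge> (1 - \<rho>) * real n}"

text \<open>The finiteness conditions are needed because \<open>card\<close> is \<open>0\<close> on infinite sets;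
  they hold automatically for a finite alphabet.\<close>

definition list_recoverable ::
    "'a set \<Rightarrow> nat \<Rightarrow> (nat \<Rightarrow> 'a) set \<Rightarrow> real \<Rightarrow> nat \<Rightarrow> nat \<Rightarrow> bool" where
  "list_recoverable \<Sigma> n C \<rho> l L \<longleftrightarrow>
     C \<subseteq> words \<Sigma> n \<and>
     (\<forall>S. (\<forall>i<n. S i \<subseteq> \<Sigma> \<and> finite (S i) \<and> card (S i) \<le> l) \<longrightarrow>
        finite (agreeing_codewords n C \<rho> S) \<and> card (agreeing_codewords n C \<rho> S) \<le> L)"

end

theory Submission
  imports Defs
begin

text \<open>
  Alteration method. Put \<open>m = L + 1\<close> and call a set of \<open>m\<close> words bad if all of them agree with a
  common choice of sets \<open>S\<^sub>i\<close> in at least \<open>(1 - \<rho>) n\<close> coordinates. If \<open>d\<^sub>i\<close> is the number of distinct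
  \<open>i\<close>-th entries of a bad set, then \<open>d\<^sub>i\<close> is at most \<open>l\<close> plus the number of words missing \<open>S\<^sub>i\<close>, so
  that \<open>\<Sum>d\<^sub>i \<le> (l + m \<rho>) n \<le> (m - L R) n\<close>. Giving a column with \<open>d\<close> distinct entries the weight
  \<open>q\<^sup>-\<^sup>d\<close>, the columns of length \<open>m\<close> have total weight at most \<open>m!\<close>; hence there are at most
  \<open>(m!)\<^sup>n q\<^bsup>(m - L R) n\<^esup>\<close> bad sets. On average a set of \<open>2 q\<^sup>k\<close> words contains at most \<open>q\<^sup>k\<close> of them,
  and deleting one word from each leaves the desired code.
\<close>

section \<open>Averaging and alteration in uniform set systems\<close>

lemma card_supersets:
  assumes "finite V" "B \<subseteq> V" "card B = m" "m \<le> T"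
  shows "card {A. A \<subseteq> V \<and> card A = T \<and> B \<subseteq> A} = (card V - m) choose (T - m)"
proof -
  have fB: "finite B" using assms finite_subset by blast
  have "bij_betw (\<lambda>A. A - B) {A. A \<subseteq> V \<and> card A = T \<and> B \<subseteq> A}
          {A. A \<subseteq> V - B \<and> card A = T - m}"
  proof (rule bij_betw_byWitness[where f' = "\<lambda>A. A \<union> B"])
    show "(\<lambda>A. A - B) ` {A. A \<subseteq> V \<and> card A = T \<and> B \<subseteq> A} \<subseteq> {A. A \<subseteq> V - B \<and> card A = T - m}"
      using assms fB by (auto simp: card_Diff_subset)
    show "(\<lambda>A. A \<union> B) ` {A. A \<subseteq> V - B \<and> card A = T - m} \<subseteq> {A. A \<subseteq> V \<and> card A = T \<and> B \<subseteq> A}"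
    proof clarify
      fix A assume A: "A \<subseteq> V - B" "card A = T - m"
      then have "card (A \<union> B) = card A + card B"
        using assms fB by (intro card_Un_disjoint) (auto intro: finite_subset)
      then show "A \<union> B \<subseteq> V \<and> card (A \<union> B) = T \<and> B \<subseteq> A \<union> B"
        using A assms by auto
    qed
  qed auto
  then have "card {A. A \<subseteq> V \<and> card A = T \<and> B \<subseteq> A} = card {A. A \<subseteq> V - B \<and> card A = T - m}"
    by (rule bij_betw_same_card)
  also have "\<dots> = (card V - m) choose (T - m)"
    using assms fB by (simp add: n_subsets card_Diff_subset)
  finally show ?thesis .
qed

text \<open>The quotient of the two binomials is the probability that a random
  \<open>T\<close>-subset of an \<open>N\<close>-set contains a fixed \<open>m\<close>-subset. It is
  the product of (T - i) / (N - i) over i < m, and each factor is at most T / N. Denominators are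
  cleared to stay in the naturals.\<close>

lemma binomial_diff_mult_power_le:
  assumes "m \<le> T" "T \<le> N"
  shows "((N - m) choose (T - m)) * N ^ m \<le> (N choose T) * T ^ m"
  using assms
proof (induction m)
  case (Suc m)
  define a b where "a = N - Suc m" and "b = T - Suc m"
  have ab: "N - m = Suc a" "T - m = Suc b" using Suc.prems by (auto simp: a_def b_def)
  \<comment> \<open>The bound (T - m) / (N - m) <= T / N on the next factor.\<close>
  have "Suc b * N \<le> Suc a * T"
  proof -
    have "T * N - m * N \<le> N * T - m * T"
      using Suc.prems by (metis diff_le_mono2 mult.commute mult_le_mono2)
    then have "(T - m) * N \<le> (N - m) * T" by (simp only: diff_mult_distrib)
    then show ?thesis by (simp only: ab)
  qed
  then have step: "(Suc b * N) * ((Suc a choose Suc b) * N ^ m) \<le> (Suc a * T) * ((N choose T) * T ^ m)"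
    by (rule mult_le_mono) (use Suc ab in simp)
  have "Suc a * ((a choose b) * N ^ Suc m) = (Suc a * (a choose b)) * N ^ Suc m"
    by (simp only: mult.assoc)
  also have "\<dots> = (Suc b * N) * ((Suc a choose Suc b) * N ^ m)"
    unfolding Suc_times_binomial_eq by (simp only: power_Suc ac_simps)
  also note step
  also have "(Suc a * T) * ((N choose T) * T ^ m) = Suc a * ((N choose T) * T ^ Suc m)"
    by (simp only: power_Suc ac_simps)
  finally have "Suc a * ((a choose b) * N ^ Suc m) \<le> Suc a * ((N choose T) * T ^ Suc m)" .
  then show ?case by (simp only: a_def [symmetric] b_def [symmetric] Suc_mult_le_cancel1)
qed simp

text \<open>Each member of \<open>E\<close> lies in at most a fraction (T / card V)^m of the
  \<open>T\<close>-subsets, so \<open>few\<close> bounds the mean number of members inside a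
  \<open>T\<close>-subset by \<open>T - M\<close>. Some \<open>T\<close>-subset does no worse than
  the mean, and removing one point of each member inside it leaves at least \<open>M\<close>
  points.\<close>

lemma independent_set_by_alteration:
  assumes V: "finite V" and E: "\<And>B. B \<in> E \<Longrightarrow> B \<subseteq> V \<and> card B = m"
    and "1 \<le> m" "m \<le> T" "T \<le> card V"
    and few: "real (card E) * real T ^ m \<le> real (T - M) * real (card V) ^ m" and "M \<le> T"
  shows "\<exists>C \<subseteq> V. card C = M \<and> (\<forall>B\<in>E. \<not> B \<subseteq> C)"
proof -
  define N where "N = card V"
  define \<A> where "\<A> = {A. A \<subseteq> V \<and> card A = T}"
  have finA: "finite \<A>" unfolding \<A>_def using V by simp
  have cardA: "card \<A> = N choose T" unfolding \<A>_def N_def using V by (rule n_subsets)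
  have finE: "finite E" by (rule finite_subset[of _ "Pow V"]) (use E V in auto)
  have Npos: "0 < N" using assms by (simp add: N_def)
  have "\<exists>A\<in>\<A>. card {B\<in>E. B \<subseteq> A} \<le> T - M"
  proof (rule ccontr)
    assume "\<not> ?thesis"
    \<comment> \<open>Double counting of the pairs \<open>B \<subseteq> A\<close>. Strictness needs
      \<open>\<A>\<close> to be nonempty, which \<open>T \<le> card V\<close> ensures.\<close>
    then have "(\<Sum>A\<in>\<A>. T - M) < (\<Sum>A\<in>\<A>. card {B\<in>E. B \<subseteq> A})"
      using finA cardA assms by (intro sum_strict_mono) (auto simp: not_le N_def)
    also have "\<dots> = (\<Sum>A\<in>\<A>. \<Sum>B\<in>E. if B \<subseteq> A then 1 else 0)"
      using finE by (simp add: sum.If_cases Int_def)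
    also have "\<dots> = (\<Sum>B\<in>E. \<Sum>A\<in>\<A>. if B \<subseteq> A then 1 else 0)"
      by (rule sum.swap)
    also have "\<dots> = (\<Sum>B\<in>E. card {A. A \<subseteq> V \<and> card A = T \<and> B \<subseteq> A})"
      using finA by (simp add: sum.If_cases Int_def \<A>_def conj_assoc)
    also have "\<dots> = card E * ((N - m) choose (T - m))"
      using E V \<open>m \<le> T\<close> by (simp add: card_supersets N_def)
    finally have "(N choose T) * (T - M) * N ^ m < card E * ((N - m) choose (T - m)) * N ^ m"
      using Npos by (simp add: cardA)
    also have "\<dots> \<le> card E * ((N choose T) * T ^ m)"
      using binomial_diff_mult_power_le[of m T N] assms by (simp add: N_def mult.assoc)
    finally have "(N choose T) * ((T - M) * N ^ m) < (N choose T) * (card E * T ^ m)"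
      by (simp add: algebra_simps)
    then have "(T - M) * N ^ m < card E * T ^ m" by simp
    then have "real ((T - M) * N ^ m) < real (card E * T ^ m)" by (simp only: of_nat_less_iff)
    with few show False by (simp add: N_def)
  qed
  then obtain A where A: "A \<subseteq> V" "card A = T" "card {B\<in>E. B \<subseteq> A} \<le> T - M"
    unfolding \<A>_def by blast
  define g where "g B = (SOME x. x \<in> B)" for B :: "'a set"
  have g: "g B \<in> B" if "B \<in> E" for B
  proof -
    have "B \<noteq> {}" using E[OF that] \<open>1 \<le> m\<close> by auto
    then show ?thesis unfolding g_def by (simp add: some_in_eq)
  qed
  define D where "D = g ` {B\<in>E. B \<subseteq> A}"
  have "card D \<le> T - M" unfolding D_def using finE A(3) by (intro order.trans[OF card_image_le]) auto
  moreover have "finite D" unfolding D_def using finE by simp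
  ultimately have "M \<le> card (A - D)" using diff_card_le_card_Diff[of D A] A(2) \<open>M \<le> T\<close> by linarith
  \<comment> \<open>\<open>A - D\<close> may have more than \<open>M\<close> points; shrinking it
    cannot bring in a member of \<open>E\<close>.\<close>
  then obtain C where C: "C \<subseteq> A - D" "card C = M" by (meson obtain_subset_with_card_n)
  have "\<not> B \<subseteq> C" if "B \<in> E" for B
    using g[OF that] C(1) that unfolding D_def by blast
  then show ?thesis using C A(1) by blast
qed

section \<open>Counting matrices by the distinct entries of their columns\<close>

text \<open>Append one entry to a column. Repeating one of the at most \<open>card J\<close> old
  values keeps the weight; a new value costs a factor 1 / \<open>card \<Sigma>\<close>, but there
  are at most \<open>card \<Sigma>\<close> of these. So the total grows by a factor of at most
  \<open>card J + 1\<close>.\<close>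

lemma sum_inverse_power_card_image_le:
  fixes J :: "'b set" and \<Sigma> :: "'a set"
  assumes "finite J" "finite \<Sigma>"
  shows "(\<Sum>X\<in>J \<rightarrow>\<^sub>E \<Sigma>. (1 / real (card \<Sigma>)) ^ card (X ` J)) \<le> fact (card J)"
  using assms(1)
proof (induction J)
  case (insert a J)
  define w where "w = 1 / real (card \<Sigma>)"
  have w0: "0 \<le> w" by (simp add: w_def)
  have split: "insert a J \<rightarrow>\<^sub>E \<Sigma> = (\<lambda>(y, X). X(a := y)) ` (\<Sigma> \<times> (J \<rightarrow>\<^sub>E \<Sigma>))"
    by (rule PiE_insert_eq)
  have inj: "inj_on (\<lambda>(y, X). X(a := y)) (\<Sigma> \<times> (J \<rightarrow>\<^sub>E \<Sigma>))"
    using inj_combinator[OF insert.hyps(2), of "\<lambda>_. \<Sigma>"] by simp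
  have im: "(X(a := y)) ` insert a J = insert y (X ` J)" for X y
    using insert.hyps(2) by auto
  have "(\<Sum>X\<in>insert a J \<rightarrow>\<^sub>E \<Sigma>. w ^ card (X ` insert a J)) =
        (\<Sum>(y, X)\<in>\<Sigma> \<times> (J \<rightarrow>\<^sub>E \<Sigma>). w ^ card (insert y (X ` J)))"
    unfolding split sum.reindex[OF inj] unfolding o_def case_prod_unfold im ..
  also have "\<dots> = (\<Sum>X\<in>J \<rightarrow>\<^sub>E \<Sigma>. \<Sum>y\<in>\<Sigma>. w ^ card (insert y (X ` J)))"
    unfolding sum.cartesian_product[symmetric] by (rule sum.swap)
  also have "\<dots> \<le> (\<Sum>X\<in>J \<rightarrow>\<^sub>E \<Sigma>. (real (card J) + 1) * w ^ card (X ` J))"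
  proof (rule sum_mono)
    fix X assume X: "X \<in> J \<rightarrow>\<^sub>E \<Sigma>"
    have sub: "X ` J \<subseteq> \<Sigma>" using X by auto
    have f: "finite (X ` J)" using insert.hyps by simp
    have "(\<Sum>y\<in>\<Sigma>. w ^ card (insert y (X ` J))) =
          (\<Sum>y\<in>\<Sigma> - X ` J. w ^ card (insert y (X ` J))) + (\<Sum>y\<in>X ` J. w ^ card (insert y (X ` J)))"
      by (rule sum.subset_diff[OF sub assms(2)])
    also have "\<dots> = (\<Sum>y\<in>\<Sigma> - X ` J. w ^ Suc (card (X ` J))) + (\<Sum>y\<in>X ` J. w ^ card (X ` J))"
      using f by (intro arg_cong2[where f = "(+)"] sum.cong) (auto simp: insert_absorb)
    also have "\<dots> = (real (card (\<Sigma> - X ` J)) * w + real (card (X ` J))) * w ^ card (X ` J)"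
      by (simp add: algebra_simps)
    also have "\<dots> \<le> (1 + real (card J)) * w ^ card (X ` J)"
    proof (rule mult_right_mono)
      have "real (card (\<Sigma> - X ` J)) \<le> real (card \<Sigma>)" using assms(2) by (simp add: card_mono)
      then have "real (card (\<Sigma> - X ` J)) * w \<le> real (card \<Sigma>) * w"
        using w0 by (rule mult_right_mono)
      \<comment> \<open>For empty \<open>\<Sigma>\<close> division by zero makes \<open>w\<close>
        equal to 0, so the bound survives.\<close>
      also have "\<dots> \<le> 1" by (simp add: w_def)
      finally show "real (card (\<Sigma> - X ` J)) * w + real (card (X ` J)) \<le> 1 + real (card J)"
        using card_image_le[OF insert.hyps(1), of X] by simp
    qed (use w0 in simp)
    finally show "(\<Sum>y\<in>\<Sigma>. w ^ card (insert y (X ` J))) \<le> (real (card J) + 1) * w ^ card (X ` J)"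
      by (simp add: add.commute)
  qed
  also have "\<dots> = (real (card J) + 1) * (\<Sum>X\<in>J \<rightarrow>\<^sub>E \<Sigma>. w ^ card (X ` J))"
    by (simp add: sum_distrib_left)
  also have "\<dots> \<le> (real (card J) + 1) * fact (card J)"
    using insert.IH by (intro mult_left_mono) (auto simp: w_def)
  also have "\<dots> = fact (card (insert a J))" using insert.hyps by (simp add: algebra_simps)
  finally show ?case by (simp add: w_def)
qed simp

text \<open>An exponential-moment bound: every counted matrix contributes at least 1 to the sum of
  q^(D - number of distinct entries). Extended to all matrices, this sum factors into one sum per
  column, which the preceding lemma bounds.\<close>

lemma card_few_distinct_entries_le:
  fixes I :: "'b set" and J :: "'c set" and \<Sigma> :: "'a set" and D :: real
  assumes "finite I" "finite J" "finite \<Sigma>" "\<Sigma> \<noteq> {}"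
  shows "real (card {Y \<in> I \<rightarrow>\<^sub>E (J \<rightarrow>\<^sub>E \<Sigma>). (\<Sum>i\<in>I. real (card (Y i ` J))) \<le> D})
           \<le> fact (card J) ^ card I * real (card \<Sigma>) powr D"
proof -
  define q where "q = real (card \<Sigma>)"
  have q: "1 \<le> q" using assms by (simp add: q_def Suc_le_eq card_gt_0_iff)
  let ?P = "I \<rightarrow>\<^sub>E (J \<rightarrow>\<^sub>E \<Sigma>)"
  let ?F = "{Y \<in> ?P. (\<Sum>i\<in>I. real (card (Y i ` J))) \<le> D}"
  have fin: "finite ?P" using assms by (intro finite_PiE) auto
  have weight: "q powr (D - (\<Sum>i\<in>I. real (card (Y i ` J)))) =
      (\<Prod>i\<in>I. (1 / q) ^ card (Y i ` J)) * q powr D" for Y :: "'b \<Rightarrow> 'c \<Rightarrow> 'a"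
  proof -
    have "q powr (\<Sum>i\<in>I. real (card (Y i ` J))) = (\<Prod>i\<in>I. q ^ card (Y i ` J))"
      using q by (simp add: powr_sum powr_realpow)
    then show ?thesis by (simp add: powr_diff power_one_over prod_dividef)
  qed
  have "real (card ?F) = (\<Sum>Y\<in>?F. 1)" by simp
  also have "\<dots> \<le> (\<Sum>Y\<in>?F. q powr (D - (\<Sum>i\<in>I. real (card (Y i ` J)))))"
    using q by (intro sum_mono) (auto intro: ge_one_powr_ge_zero)
  also have "\<dots> \<le> (\<Sum>Y\<in>?P. q powr (D - (\<Sum>i\<in>I. real (card (Y i ` J)))))"
    using fin by (intro sum_mono2) auto
  also have "\<dots> = (\<Sum>Y\<in>?P. \<Prod>i\<in>I. (1 / q) ^ card (Y i ` J)) * q powr D"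
    by (simp add: weight sum_distrib_right)
  also have "(\<Sum>Y\<in>?P. \<Prod>i\<in>I. (1 / q) ^ card (Y i ` J)) =
      (\<Prod>i\<in>I. \<Sum>X\<in>J \<rightarrow>\<^sub>E \<Sigma>. (1 / q) ^ card (X ` J))"
    using assms by (intro prod_sum_PiE[symmetric]) (auto intro: finite_PiE)
  also have "\<dots> \<le> (\<Prod>i\<in>I. fact (card J))"
    using sum_inverse_power_card_image_le[OF assms(2,3)] q
    by (intro prod_mono) (auto simp: q_def intro: sum_nonneg)
  finally show ?thesis using q by (simp add: q_def mult_right_mono)
qed

section \<open>Bad sets of words and their number\<close>

definition bad_sets :: "'a set \<Rightarrow> nat \<Rightarrow> real \<Rightarrow> nat \<Rightarrow> nat \<Rightarrow> (nat \<Rightarrow> 'a) set set" where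
  "bad_sets \<Sigma> n \<rho> l m = {B. B \<subseteq> words \<Sigma> n \<and> card B = m \<and>
     (\<exists>S. (\<forall>i<n. S i \<subseteq> \<Sigma> \<and> finite (S i) \<and> card (S i) \<le> l) \<and> agreeing_codewords n B \<rho> S = B)}"

text \<open>Agreement with \<open>S\<close> is tested word by word, so any \<open>L + 1\<close>
  words of an oversized list form a bad set by themselves. Badness does not refer to the code, which
  makes avoiding bad sets a problem about independent sets.\<close>

lemma list_recoverable_if_no_bad_subset:
  assumes "finite \<Sigma>" "C \<subseteq> words \<Sigma> n" "\<And>B. B \<in> bad_sets \<Sigma> n \<rho> l (L + 1) \<Longrightarrow> \<not> B \<subseteq> C"
  shows "list_recoverable \<Sigma> n C \<rho> l L"
  unfolding list_recoverable_def
proof (intro conjI allI impI)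
  fix S assume S: "\<forall>i<n. S i \<subseteq> \<Sigma> \<and> finite (S i) \<and> card (S i) \<le> l"
  let ?A = "agreeing_codewords n C \<rho> S"
  have sub: "?A \<subseteq> C" by (auto simp: agreeing_codewords_def)
  show "finite ?A" 
    using assms sub by (meson finite_PiE finite_lessThan finite_subset)
  show "card ?A \<le> L"
  proof (rule ccontr)
    assume "\<not> ?thesis"
    then obtain B where B: "B \<subseteq> ?A" "card B = L + 1"
      by (metis Suc_eq_plus1 not_less_eq_eq obtain_subset_with_card_n)
    then have "agreeing_codewords n B \<rho> S = B" by (auto simp: agreeing_codewords_def)
    then have "B \<in> bad_sets \<Sigma> n \<rho> l (L + 1)"
      using B S sub assms(2) unfolding bad_sets_def by blast
    then show False using assms(3) B sub by blast
  qed
qed (use assms in auto)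

text \<open>At coordinate \<open>i\<close>, at most \<open>l\<close> values lie in
  \<open>S i\<close>, and each remaining one comes from a word that misses \<open>S i\<close>.
  Summing the misses by words instead of coordinates gives at most \<open>\<rho> * n\<close> per
  word.\<close>

lemma sum_distinct_entries_le:
  assumes "finite J"
    and S: "\<forall>i<n. finite (S i) \<and> card (S i) \<le> l"
    and agree: "\<And>j. j \<in> J \<Longrightarrow> (1 - \<rho>) * real n \<le> real (card {i. i < n \<and> c j i \<in> S i})"
  shows "(\<Sum>i<n. real (card ((\<lambda>j. c j i) ` J))) \<le> (real l + real (card J) * \<rho>) * real n"
proof -
  have "(\<Sum>i<n. card ((\<lambda>j. c j i) ` J)) \<le> (\<Sum>i<n. l + card {j\<in>J. c j i \<notin> S i})"
  proof (rule sum_mono)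
    fix i assume i: "i \<in> {..<n}"
    let ?M = "{j\<in>J. c j i \<notin> S i}"
    have "card ((\<lambda>j. c j i) ` J) \<le> card (S i \<union> (\<lambda>j. c j i) ` ?M)"
      using i S assms(1) by (intro card_mono) auto
    also have "\<dots> \<le> card (S i) + card ((\<lambda>j. c j i) ` ?M)" by (rule card_Un_le)
    also have "\<dots> \<le> l + card ?M"
      using i S assms(1) by (intro add_mono card_image_le) auto
    finally show "card ((\<lambda>j. c j i) ` J) \<le> l + card ?M" .
  qed
  also have "\<dots> = l * n + (\<Sum>i<n. \<Sum>j\<in>J. if c j i \<notin> S i then 1 else 0)"
    using assms(1) by (simp add: sum.distrib sum.If_cases Int_def)
  also have "\<dots> = l * n + (\<Sum>j\<in>J. \<Sum>i<n. if c j i \<notin> S i then 1 else 0)"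
    by (subst sum.swap) simp
  also have "\<dots> = l * n + (\<Sum>j\<in>J. card {i. i < n \<and> c j i \<notin> S i})"
    by (simp add: sum.If_cases Int_def)
  finally have "(\<Sum>i<n. real (card ((\<lambda>j. c j i) ` J)))
      \<le> real l * real n + (\<Sum>j\<in>J. real (card {i. i < n \<and> c j i \<notin> S i}))"
    by (simp flip: of_nat_sum of_nat_mult of_nat_add)
  also have "(\<Sum>j\<in>J. real (card {i. i < n \<and> c j i \<notin> S i})) \<le> (\<Sum>j\<in>J. \<rho> * real n)"
  proof (rule sum_mono)
    fix j assume "j \<in> J"
    have "card {i. i < n \<and> c j i \<in> S i} + card {i. i < n \<and> c j i \<notin> S i} =
          card ({i. i < n \<and> c j i \<in> S i} \<union> {i. i < n \<and> c j i \<notin> S i})"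
      by (intro card_Un_disjoint[symmetric]) auto
    also have "{i. i < n \<and> c j i \<in> S i} \<union> {i. i < n \<and> c j i \<notin> S i} = {..<n}" by auto
    finally show "real (card {i. i < n \<and> c j i \<notin> S i}) \<le> \<rho> * real n"
      using agree[OF \<open>j \<in> J\<close>] by (simp add: algebra_simps)
  qed
  finally show ?thesis by (simp add: algebra_simps)
qed

text \<open>A bad set is encoded by listing its words as the rows of a matrix stored by columns.
  Different orderings encode the same set, which is harmless: \<open>rows\<close> only has to cover
  the bad sets.\<close>

lemma card_bad_sets_le:
  assumes \<Sigma>: "finite \<Sigma>" "\<Sigma> \<noteq> {}"
  shows "real (card (bad_sets \<Sigma> n \<rho> l m))
           \<le> fact m ^ n * real (card \<Sigma>) powr ((real l + real m * \<rho>) * real n)"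
proof -
  define D where "D = (real l + real m * \<rho>) * real n"
  define F where "F = {Y \<in> {..<n} \<rightarrow>\<^sub>E ({..<m} \<rightarrow>\<^sub>E \<Sigma>). (\<Sum>i<n. real (card (Y i ` {..<m}))) \<le> D}"
  define rows where "rows Y = (\<lambda>j. \<lambda>i\<in>{..<n}. Y i j) ` {..<m}" for Y :: "nat \<Rightarrow> nat \<Rightarrow> 'a"
  have finF: "finite F" unfolding F_def using \<Sigma> by (auto intro!: finite_PiE)
  have "bad_sets \<Sigma> n \<rho> l m \<subseteq> rows ` F"
  proof
    fix B assume "B \<in> bad_sets \<Sigma> n \<rho> l m"
    then obtain S where B: "B \<subseteq> words \<Sigma> n" "card B = m"
      and S: "\<forall>i<n. S i \<subseteq> \<Sigma> \<and> finite (S i) \<and> card (S i) \<le> l" "agreeing_codewords n B \<rho> S = B"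
      unfolding bad_sets_def by blast
    have "finite B" using B(1) \<Sigma>(1) by (meson finite_PiE finite_lessThan finite_subset)
    then obtain c where c: "bij_betw c {..<m} B"
      using B(2) ex_bij_betw_nat_finite[of B] by (auto simp: atLeast0LessThan)
    have cB: "c j \<in> B" if "j < m" for j using c that by (auto simp: bij_betw_def)
    have cw: "c j \<in> words \<Sigma> n" if "j < m" for j using cB[OF that] B(1) by blast
    define Y where "Y = (\<lambda>i\<in>{..<n}. \<lambda>j\<in>{..<m}. c j i)"
    have "(\<lambda>i\<in>{..<n}. Y i j) = c j" if "j < m" for j
      using cw[OF that] that by (auto simp: Y_def fun_eq_iff PiE_def extensional_def)
    then have "rows Y = c ` {..<m}" unfolding rows_def by (intro image_cong) auto
    then have "rows Y = B" using c by (simp add: bij_betw_def)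
    moreover have "Y \<in> {..<n} \<rightarrow>\<^sub>E ({..<m} \<rightarrow>\<^sub>E \<Sigma>)"
      using cw unfolding Y_def by (auto simp: PiE_def Pi_def)
    moreover have "(\<Sum>i<n. real (card (Y i ` {..<m}))) \<le> D"
    proof -
      have "(1 - \<rho>) * real n \<le> real (card {i. i < n \<and> c j i \<in> S i})" if "j \<in> {..<m}" for j
        using S(2) cB[of j] that unfolding agreeing_codewords_def by auto
      then have "(\<Sum>i<n. real (card ((\<lambda>j. c j i) ` {..<m}))) \<le> D"
        using sum_distinct_entries_le[of "{..<m}" n S l \<rho> c] S(1) by (simp add: D_def)
      moreover have "Y i ` {..<m} = (\<lambda>j. c j i) ` {..<m}" if "i < n" for i
        using that unfolding Y_def by (intro image_cong) auto
      ultimately show ?thesis by simp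
    qed
    ultimately show "B \<in> rows ` F" unfolding F_def by blast
  qed
  then have "card (bad_sets \<Sigma> n \<rho> l m) \<le> card F"
    using finF by (rule surj_card_le[rotated])
  also have "real (card F) \<le> fact m ^ n * real (card \<Sigma>) powr D"
    using card_few_distinct_entries_le[of "{..<n}" "{..<m}" \<Sigma> D] \<Sigma> by (simp add: F_def)
  finally show ?thesis by (simp add: D_def)
qed

section \<open>Choice of parameters\<close>

theorem corollary3p9:
  fixes n q l L k :: nat and \<Sigma> :: "'a set" and R \<rho> :: real
  assumes "n \<ge> 2"
    and "finite \<Sigma>" and "card \<Sigma> = q"
    and "q > L" and "L \<ge> l" and "l \<ge> 1"
    and "0 \<le> R" and "R \<le> 1"
    and "0 \<le> \<rho>" and "\<rho> \<le> 1"
    and "\<rho> \<le> (real L + 1 - real l) / (real L + 1) - real L / (real L + 1) * R"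
    and "int k = \<lfloor>R * real n
                    - (real L + 1) * ln (real L + 1) / ln (real q) * (real n + 3) - 1\<rfloor>"
    and "k \<ge> 1"
  shows "\<exists>C. C \<subseteq> words \<Sigma> n \<and> card C = q ^ k \<and> list_recoverable \<Sigma> n C \<rho> l L"
proof -
  define m where "m = L + 1"
  have L: "1 \<le> L" and m: "2 \<le> m" "real m = real L + 1" using assms by (auto simp: m_def)
  have q: "2 \<le> q" "m \<le> q" "1 < real q" "\<Sigma> \<noteq> {}" using assms L by (auto simp: m_def)
  \<comment> \<open>The loss in the rate, scaled so that q^e = m^(m (n + 3)).\<close>
  define e where "e = real m * ln (real m) / ln (real q) * (real n + 3)"
  have "0 \<le> e" unfolding e_def using m q by simp
  have k: "real k \<le> R * real n - e - 1"
  proof -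
    have "real_of_int (int k) \<le> R * real n
        - (real L + 1) * ln (real L + 1) / ln (real q) * (real n + 3) - 1"
      unfolding assms(12) by (rule of_int_floor_le)
    then show ?thesis by (simp add: e_def m)
  qed
  have "R * real n \<le> real n" using assms by (simp add: mult_left_le_one_le)
  then have "k + 1 \<le> n" using k \<open>0 \<le> e\<close> by linarith
  have T_le: "2 * q ^ k \<le> q ^ n"
  proof -
    have "2 * q ^ k \<le> q ^ (k + 1)" using q by simp
    also have "\<dots> \<le> q ^ n" using \<open>k + 1 \<le> n\<close> q by (intro power_increasing) auto
    finally show ?thesis .
  qed
  have m_le: "m \<le> 2 * q ^ k"
  proof -
    have "q \<le> q ^ k" using \<open>k \<ge> 1\<close> q by (simp add: self_le_power)
    then show ?thesis using q by linarith
  qed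
  have card_words: "card (words \<Sigma> n) = q ^ n" using assms by (simp add: card_PiE)
  have e_powr: "real q powr e = real m powr (real m * (real n + 3))"
    using q m by (simp add: powr_def e_def)
  \<comment> \<open>The loss pays for the constants: m!^n 2^m <= m^(m (n + 1)) <= q^e <= q^(L e),
    and e + k <= R n.\<close>
  have key: "fact m ^ n * 2 ^ m * real q powr (real L * real k) \<le> real q powr (real L * R * real n)"
  proof -
    have "fact m ^ n * 2 ^ m \<le> (real m ^ m) ^ n * real m ^ m"
      using m fact_le_power[of m, where ?'a = real] by (intro mult_mono power_mono) auto
    also have "\<dots> = real m powr (real m * (real n + 1))"
      using m by (simp add: powr_realpow[symmetric] powr_add[symmetric] powr_powr algebra_simps
          flip: power_mult)
    also have "\<dots> \<le> real m powr (real m * (real n + 3))" using m by (intro powr_mono) auto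
    also have "\<dots> = real q powr e" by (simp add: e_powr)
    also have "\<dots> \<le> real q powr (real L * e)"
      using L q \<open>0 \<le> e\<close> by (intro powr_mono) (auto simp: mult_le_cancel_right1)
    finally have "fact m ^ n * 2 ^ m * real q powr (real L * real k)
        \<le> real q powr (real L * e) * real q powr (real L * real k)"
      by (rule mult_right_mono) simp
    also have "\<dots> = real q powr (real L * (e + real k))" by (simp add: powr_add algebra_simps)
    also have "\<dots> \<le> real q powr (real L * (R * real n))"
      using k q by (intro powr_mono mult_left_mono) auto
    finally show ?thesis by (simp add: mult.assoc)
  qed
  \<comment> \<open>The hypothesis on \<rho> multiplied by \<open>m\<close>; it bounds the exponent
    in the count of bad sets.\<close>
  have \<rho>: "real l + real m * \<rho> \<le> real m - real L * R"
  proof -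
    have "real m * \<rho> \<le> real m * ((real L + 1 - real l) / real m - real L / real m * R)"
      using assms(11) m by (intro mult_left_mono) auto
    also have "\<dots> = real m * ((real L + 1 - real l) / real m) - real m * (real L / real m * R)"
      by (rule right_diff_distrib)
    also have "real m * ((real L + 1 - real l) / real m) = real L + 1 - real l"
      using m(1) by simp
    also have "real m * (real L / real m * R) = real L * R" using m(1) by simp
    also have "real L + 1 - real l - real L * R = real m - real l - real L * R"
      using m(2) by simp
    finally show ?thesis by simp
  qed
  \<comment> \<open>Starting from 2 q^k words allows q^k deletions, at the price of the factor
    2^m.\<close>
  have few: "real (card (bad_sets \<Sigma> n \<rho> l m)) * real (2 * q ^ k) ^ m
      \<le> real (2 * q ^ k - q ^ k) * real (card (words \<Sigma> n)) ^ m"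
  proof -
    let ?Q = "\<lambda>x. real q powr x"
    \<comment> \<open>Since m = L + 1, one factor q^k splits off; it matches the q^k allowed
      deletions, and \<open>key\<close> absorbs the rest.\<close>
    have T_pow: "real (2 * q ^ k) ^ m = 2 ^ m * ?Q (real L * real k) * ?Q (real k)"
      using q by (simp add: power_mult_distrib m_def powr_add[symmetric] powr_realpow[symmetric]
          powr_powr algebra_simps flip: power_mult)
    have "real (card (bad_sets \<Sigma> n \<rho> l m)) \<le> fact m ^ n * ?Q ((real l + real m * \<rho>) * real n)"
      using card_bad_sets_le[of \<Sigma> n \<rho> l m] assms q by simp
    also have "\<dots> \<le> fact m ^ n * ?Q ((real m - real L * R) * real n)"
      using \<rho> q by (intro mult_left_mono powr_mono mult_right_mono) auto
    finally have "real (card (bad_sets \<Sigma> n \<rho> l m)) * real (2 * q ^ k) ^ m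
        \<le> fact m ^ n * ?Q ((real m - real L * R) * real n) * real (2 * q ^ k) ^ m"
      by (rule mult_right_mono) simp
    also have "\<dots> = fact m ^ n * ?Q ((real m - real L * R) * real n)
        * (2 ^ m * ?Q (real L * real k) * ?Q (real k))"
      by (simp only: T_pow)
    also have "\<dots> = (fact m ^ n * 2 ^ m * ?Q (real L * real k))
        * (?Q ((real m - real L * R) * real n) * ?Q (real k))"
      by (simp only: ac_simps)
    also have "\<dots> \<le> ?Q (real L * R * real n) * (?Q ((real m - real L * R) * real n) * ?Q (real k))"
      by (rule mult_right_mono[OF key]) simp
    \<comment> \<open>The terms L R n in the exponents cancel, leaving the m-th power of the number
      of words.\<close>
    also have "\<dots> = ?Q (real k) * ?Q (real n * real m)"
      by (simp add: powr_add[symmetric] algebra_simps)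
    also have "\<dots> = real (2 * q ^ k - q ^ k) * real (card (words \<Sigma> n)) ^ m"
      using q by (simp add: card_words powr_realpow power_mult flip: of_nat_mult)
    finally show ?thesis .
  qed
  have "\<exists>C \<subseteq> words \<Sigma> n. card C = q ^ k \<and> (\<forall>B\<in>bad_sets \<Sigma> n \<rho> l m. \<not> B \<subseteq> C)"
  proof (rule independent_set_by_alteration[OF _ _ _ m_le _ few])
    show "finite (words \<Sigma> n)" using assms by (intro finite_PiE) auto
  qed (use m T_le card_words in \<open>auto simp: bad_sets_def\<close>)
  then show ?thesis using list_recoverable_if_no_bad_subset assms(2) unfolding m_def by metis
qed

end
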